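(* Let $A=\{(x_n,y_n)\colon n\in\mathbb{N}\}\subseteq\mathbb{Q}\times\mathbb{Q}$ be a subset such that $\{x_n\colon n\in\mathbb{N}\}=\{y_n\colon n\in\mathbb{N}\}=\mathbb{Q}$ and, for every $n\in\mathbb{N}$, the sections $A_{x_n}=\{y\in\mathbb{Q}\colon (x_n,y)\in A\}$ and $A^{y_n}=\{x\in\mathbb{Q}\colon (x,y_n)\in A\}$ are singletons. Then there exists a separate continuous function $f\colon\mathbb{Q}\times\mathbb{Q}\to[0,1]$ such that $f[A]$ is a singleton, but the image $f[\mathbb{Q}\times\mathbb{Q}]$ is dense in $[0,1]$.
   Context: $\mathbb{Q}$ and $[0,1]$ carry their usual topologies inherited from $\mathbb{R}$. A function $f\colon X\times Y\to Z$ between topological spaces is called separate continuous if, for each $(x,y)\in X\times Y$, the functions $f(x,\cdot)\colon Y\to Z$ and $f(\cdot,y)\colon X\to Z$ are continuous. For a set $D$, $f[D]$ denotes the image of $D$ under $f$. *)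

theory Defs
  imports "HOL-Analysis.Analysis"
begin

definition separately_continuous_map ::
    "'a topology \<Rightarrow> 'b topology \<Rightarrow> 'c topology \<Rightarrow> ('a \<times> 'b \<Rightarrow> 'c) \<Rightarrow> bool" where
  "separately_continuous_map X Y Z f \<longleftrightarrow>
     (\<forall>x \<in> topspace X. \<forall>y \<in> topspace Y.
        continuous_map Y Z (\<lambda>v. f (x, v)) \<and> continuous_map X Z (\<lambda>u. f (u, y)))"

end

theory Submission
  imports Defs
begin

text \<open>
  Only countably many rows and columns of \<open>\<rat> \<times> \<rat>\<close> matter, so they can be made continuous one at
  a time. When a new row is treated, only its finitely many intersections with earlier columns and
  with \<open>A\<close> carry values that must be kept, and these values extend continuously to the whole row.
  Starting with the row \<open>v \<mapsto> min 1 \<bar>v - y\<^sub>0\<bar>\<close> makes the image dense.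
\<close>

text \<open>A finite set in a metric space is closed and discrete, so \<open>f\<close> is continuous
  on \<open>S\<close>, and Tietze's theorem extends it without leaving the interval.\<close>

lemma finite_interpolation:
  fixes f :: "'a::{metric_space,second_countable_topology} \<Rightarrow> real"
  assumes "finite S" and "\<And>v. f v \<in> {0..1}"
  obtains g where "continuous_on UNIV g" "\<And>v. g v \<in> {0..1}" "\<And>v. v \<in> S \<Longrightarrow> g v = f v"
proof -
  have "closedin (top_of_set UNIV) S"
    using assms(1) by (simp add: finite_imp_closed)
  moreover have "f v \<in> cbox 0 1" for v
    using assms(2) by simp
  ultimately obtain g where "continuous_on UNIV g" "\<And>v. v \<in> S \<Longrightarrow> g v = f v"
      "\<And>v. v \<in> UNIV \<Longrightarrow> g v \<in> cbox 0 1"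
    using Tietze_closed_interval_1[OF continuous_on_finite[OF assms(1)], of UNIV 0 1 f] by auto
  then show ?thesis
    using that by simp
qed

text \<open>\<open>R\<close> and \<open>C\<close> collect the rows and columns already treated.
  \<open>F\<close> is total: its other values are provisional, but the bounds and the zeros on
  \<open>A\<close> hold at every stage.\<close>

definition partial_solution ::
    "('a::{metric_space,second_countable_topology} \<times> 'b::{metric_space,second_countable_topology}) set \<Rightarrow>
      'a set \<Rightarrow> 'b set \<Rightarrow> ('a \<Rightarrow> 'b \<Rightarrow> real) \<Rightarrow> bool" where
  "partial_solution A R C F \<longleftrightarrow>
     (\<forall>u v. F u v \<in> {0..1}) \<and> (\<forall>(u, v) \<in> A. F u v = 0) \<and>
     (\<forall>a \<in> R. continuous_on UNIV (F a)) \<and> (\<forall>b \<in> C. continuous_on UNIV (\<lambda>u. F u b))"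

lemma partial_solution_converse:
  "partial_solution (A\<inverse>) C R (\<lambda>v u. F u v) \<longleftrightarrow> partial_solution A R C F"
  unfolding partial_solution_def by auto

text \<open>Row \<open>a\<close> meets \<open>A\<close> and the columns in \<open>C\<close> in
  finitely many points only. Interpolating through them gives a continuous row that leaves the
  columns in \<open>C\<close> untouched.\<close>

lemma partial_solution_add_row:
  assumes F: "partial_solution A R C F" and "finite C" and "finite (A `` {a})"
  obtains F' where "partial_solution A (insert a R) C F'"
    and "\<And>u v. u \<in> R \<or> v \<in> C \<Longrightarrow> F' u v = F u v"
proof (cases "a \<in> R")
  case True
  with F that show ?thesis by (metis insert_absorb)
next
  case False
  have "finite (C \<union> A `` {a})" and "\<And>v. F a v \<in> {0..1}"
    using assms by (auto simp: partial_solution_def)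
  then obtain g where g: "continuous_on UNIV g" "\<And>v. g v \<in> {0..1}"
      "\<And>v. v \<in> C \<union> A `` {a} \<Longrightarrow> g v = F a v"
    using finite_interpolation[of "C \<union> A `` {a}" "F a"] by blast
  let ?G = "F(a := g)"
  \<comment> \<open>Overwriting row \<open>a\<close> spares the rows in \<open>R\<close> because
    \<open>a\<close> is not among them; in row \<open>a\<close> itself, \<open>g\<close> was fitted
    at these points.\<close>
  have agree: "?G u v = F u v" if "u \<in> R \<or> v \<in> C \<or> (u, v) \<in> A" for u v
    using that False g(3) by auto
  have "partial_solution A (insert a R) C ?G"
    unfolding partial_solution_def
  proof (intro conjI ballI allI)
    fix u v show "?G u v \<in> {0..1}"
      using F g(2) by (simp add: partial_solution_def)
  next
    fix p assume "p \<in> A"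
    then show "case p of (u, v) \<Rightarrow> ?G u v = 0"
      using F agree by (auto simp: partial_solution_def)
  next
    fix c assume "c \<in> insert a R"
    then show "continuous_on UNIV (?G c)"
      using F g(1) by (auto simp: partial_solution_def)
  next
    fix b assume "b \<in> C"
    then have "(\<lambda>u. ?G u b) = (\<lambda>u. F u b)" using agree by blast
    then show "continuous_on UNIV (\<lambda>u. ?G u b)"
      using F \<open>b \<in> C\<close> unfolding partial_solution_def by metis
  qed
  then show ?thesis
    using that agree by blast
qed

text \<open>A column is a row of the converse problem. The new row \<open>a\<close> counts as
  treated when column \<open>b\<close> is added, so it survives that step.\<close>

lemma partial_solution_add_row_column:
  assumes F: "partial_solution A R C F" and "finite R" and "finite C"
    and "finite (A `` {a})" and "finite (A\<inverse> `` {b})"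
  obtains F' where "partial_solution A (insert a R) (insert b C) F'"
    and "\<And>u v. u \<in> R \<or> v \<in> C \<Longrightarrow> F' u v = F u v"
proof -
  obtain G where G: "partial_solution A (insert a R) C G"
      "\<And>u v. u \<in> R \<or> v \<in> C \<Longrightarrow> G u v = F u v"
    using partial_solution_add_row assms by blast
  have "partial_solution (A\<inverse>) C (insert a R) (\<lambda>v u. G u v)"
    using G(1) by (simp add: partial_solution_converse)
  then obtain H where H: "partial_solution (A\<inverse>) (insert b C) (insert a R) H"
      "\<And>v u. v \<in> C \<or> u \<in> insert a R \<Longrightarrow> H v u = G u v"
    using partial_solution_add_row[of "A\<inverse>" C "insert a R" "\<lambda>v u. G u v" b] assms by auto
  have "partial_solution A (insert a R) (insert b C) (\<lambda>u v. H v u)"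
    using H(1) partial_solution_converse[of A "insert b C" "insert a R" "\<lambda>u v. H v u"] by simp
  then show ?thesis
    using that G(2) H(2) by (metis insertCI)
qed

text \<open>Treated rows and columns never change again, so the stages have a well-defined limit
  that inherits their continuity.\<close>

proposition separately_continuous_extension_of_row:
  fixes x :: "nat \<Rightarrow> 'a::{metric_space,second_countable_topology}"
    and y :: "nat \<Rightarrow> 'b::{metric_space,second_countable_topology}"
  assumes rows: "\<And>u. finite (A `` {u})" and columns: "\<And>v. finite (A\<inverse> `` {v})"
    and g: "continuous_on UNIV g" "\<And>v. g v \<in> {0..1}" "\<And>v. (a, v) \<in> A \<Longrightarrow> g v = 0"
  obtains f where "partial_solution A (range x) (range y) f" "f a = g"
proof -
  \<comment> \<open>Row \<open>a\<close> is treated from stage 0 on, which protects \<open>g\<close>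
    throughout.\<close>
  define R where "R n = insert a (x ` {..<n})" for n
  define C where "C n = y ` {..<n}" for n
  have Suc: "R (Suc n) = insert (x n) (R n)" "C (Suc n) = insert (y n) (C n)" for n
    unfolding R_def C_def by (auto simp: lessThan_Suc)
  have "\<exists>F. \<forall>n. (partial_solution A (R n) (C n) (F n) \<and> (n = 0 \<longrightarrow> F n a = g)) \<and>
      (\<forall>u v. u \<in> R n \<or> v \<in> C n \<longrightarrow> F (Suc n) u v = F n u v)"
  proof (rule dependent_nat_choice, goal_cases)
    case 1
    \<comment> \<open>No column is treated at stage 0, so \<open>g\<close> extended by zero off row
      \<open>a\<close> will do.\<close>
    show ?case
      using g by (intro exI[of _ "\<lambda>u. if u = a then g else (\<lambda>v. 0)"])
        (auto simp: partial_solution_def R_def C_def)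
  next
    case (2 F n)
    have "finite (R n)" "finite (C n)"
      unfolding R_def C_def by auto
    with 2 obtain F' where "partial_solution A (insert (x n) (R n)) (insert (y n) (C n)) F'"
        "\<And>u v. u \<in> R n \<or> v \<in> C n \<Longrightarrow> F' u v = F u v"
      using partial_solution_add_row_column[of A "R n" "C n" F "x n" "y n"] rows columns by blast
    then show ?case unfolding Suc by (intro exI[of _ F']) simp
  qed
  then obtain F where F: "\<And>n. partial_solution A (R n) (C n) (F n)" and F0: "F 0 a = g"
    and F_Suc: "\<And>n u v. u \<in> R n \<or> v \<in> C n \<Longrightarrow> F (Suc n) u v = F n u v"
    by blast
  have stable: "F m u v = F n u v" if "u \<in> R n \<or> v \<in> C n" "n \<le> m" for m n u v
    using that(2)
  proof (induction rule: dec_induct)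
    case (step k)
    have "u \<in> R k \<or> v \<in> C k"
      using that(1) step.hyps by (auto simp: R_def C_def)
    then show ?case using F_Suc step.IH by simp
  qed simp
  \<comment> \<open>This takes the value at the first stage that fixes it. If no stage does,
    \<open>LEAST\<close> is some unspecified stage, where the bounds and the zeros on
    \<open>A\<close> still hold.\<close>
  define f where "f u v = F (LEAST n. u \<in> R n \<or> v \<in> C n) u v" for u v
  have f: "f u v = F n u v" if "u \<in> R n \<or> v \<in> C n" for n u v
    unfolding f_def
    using LeastI[of "\<lambda>n. u \<in> R n \<or> v \<in> C n", OF that]
      Least_le[of "\<lambda>n. u \<in> R n \<or> v \<in> C n", OF that]
    by (rule stable[symmetric])
  have "continuous_on UNIV (f (x i))" for i
  proof -
    \<comment> \<open>Stage \<open>Suc i\<close> has treated index \<open>i\<close>, so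
      \<open>f\<close> agrees with it along the entire row.\<close>
    have "x i \<in> R (Suc i)" by (simp add: Suc)
    moreover from this have "f (x i) = F (Suc i) (x i)" using f by blast
    ultimately show ?thesis using F[of "Suc i"] by (simp add: partial_solution_def)
  qed
  moreover have "continuous_on UNIV (\<lambda>u. f u (y i))" for i
  proof -
    have "y i \<in> C (Suc i)" by (simp add: Suc)
    moreover from this have "(\<lambda>u. f u (y i)) = (\<lambda>u. F (Suc i) u (y i))" using f by blast
    ultimately show ?thesis using F[of "Suc i"] unfolding partial_solution_def by metis
  qed
  ultimately have "partial_solution A (range x) (range y) f"
    using F by (simp add: partial_solution_def f_def case_prod_beta)
  moreover have "f a = g"
    using f[of a 0] F0 by (auto simp: R_def)
  ultimately show ?thesis using that by blast
qed

theorem theorem2: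
  fixes x y :: "nat \<Rightarrow> real" and A :: "(real \<times> real) set"
  assumes "A = {(x n, y n) | n. True}"
    and "A \<subseteq> \<rat> \<times> \<rat>"
    and "range x = \<rat>"
    and "range y = \<rat>"
    and "\<And>n. is_singleton {v \<in> \<rat>. (x n, v) \<in> A}"
    and "\<And>n. is_singleton {u \<in> \<rat>. (u, y n) \<in> A}"
  shows "\<exists>f :: real \<times> real \<Rightarrow> real.
           separately_continuous_map (top_of_set \<rat>) (top_of_set \<rat>) (top_of_set {0..1}) f \<and>
           is_singleton (f ` A) \<and>
           top_of_set {0..1} closure_of (f ` (\<rat> \<times> \<rat>)) = {0..1}"
proof -
  have row: "A `` {x n} = {v \<in> \<rat>. (x n, v) \<in> A}" for n
    using assms(2) by auto
  have column: "A\<inverse> `` {y n} = {u \<in> \<rat>. (u, y n) \<in> A}" for n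
    using assms(2) by auto
  \<comment> \<open>The construction runs on the real plane, so irrational sections count too; they
    are empty.\<close>
  have rows: "finite (A `` {u})" for u
  proof (cases "u \<in> \<rat>")
    case True
    then obtain n where "u = x n" using assms(3) by blast
    then show ?thesis using row assms(5)[of n] by (auto elim!: is_singletonE)
  next
    case False
    then have "A `` {u} = {}" using assms(2) by auto
    then show ?thesis by simp
  qed
  have columns: "finite (A\<inverse> `` {v})" for v
  proof (cases "v \<in> \<rat>")
    case True
    then obtain n where "v = y n" using assms(4) by blast
    then show ?thesis using column assms(6)[of n] by (auto elim!: is_singletonE)
  next
    case False
    then have "A\<inverse> `` {v} = {}" using assms(2) by auto
    then show ?thesis by simp
  qed
  \<comment> \<open>In row \<open>x 0\<close> the set \<open>A\<close> has only the point with
    second coordinate \<open>y 0\<close>, where \<open>g\<close> vanishes.\<close>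
  define g where "g v = min 1 \<bar>v - y 0\<bar>" for v
  have in_A: "(x n, y n) \<in> A" for n
    using assms(1) by blast
  have "g v = 0" if "(x 0, v) \<in> A" for v
  proof -
    have "v \<in> A `` {x 0}" "y 0 \<in> A `` {x 0}" using that in_A by auto
    then have "v = y 0" using assms(5)[of 0] unfolding row by (metis is_singletonE singletonD)
    then show ?thesis by (simp add: g_def)
  qed
  moreover have "continuous_on UNIV g"
    unfolding g_def by (intro continuous_intros)
  moreover have "g v \<in> {0..1}" for v
    by (simp add: g_def)
  ultimately obtain f where f: "partial_solution A (range x) (range y) f" and f0: "f (x 0) = g"
    using separately_continuous_extension_of_row[OF rows columns] by blast
  \<comment> \<open>The treated rows and columns are exactly the rational ones; their continuity on
    the real line restricts to \<rat>.\<close>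
  have "separately_continuous_map (top_of_set \<rat>) (top_of_set \<rat>) (top_of_set {0..1}) (case_prod f)"
    using f assms(3,4) unfolding partial_solution_def separately_continuous_map_def
    by (auto simp: continuous_map_in_subtopology intro: continuous_on_subset)
  moreover have "case_prod f ` A = {0}"
    using f in_A by (force simp: partial_solution_def image_iff)
  moreover have "{0..1} \<subseteq> closure (case_prod f ` (\<rat> \<times> \<rat>))"
  proof -
    \<comment> \<open>Row \<open>x 0\<close> alone suffices for density: \<open>g\<close> takes the
      value \<open>r\<close> at the rational point \<open>y 0 + r\<close>.\<close>
    have "{0<..<1} \<inter> \<rat> \<subseteq> case_prod f ` (\<rat> \<times> \<rat>)"
    proof
      fix r :: real assume r: "r \<in> {0<..<1} \<inter> \<rat>"
      have "x 0 \<in> \<rat>" "y 0 + r \<in> \<rat>" using r assms(3,4) by (blast intro: Rats_add)+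
      moreover have "f (x 0) (y 0 + r) = r" using r by (simp add: f0 g_def)
      ultimately show "r \<in> case_prod f ` (\<rat> \<times> \<rat>)" by force
    qed
    then have "closure ({0<..<1} \<inter> \<rat>) \<subseteq> closure (case_prod f ` (\<rat> \<times> \<rat>))"
      by (rule closure_mono)
    \<comment> \<open>Intersecting an open set with a dense set does not change its closure.\<close>
    moreover have "closure ({0<..<1::real} \<inter> \<rat>) = {0..1}"
      using closure_open_Int_superset[of "{0<..<1::real}" \<rat>] by (simp add: Rats_closure_real)
    ultimately show ?thesis by simp
  qed
  moreover have "case_prod f ` (\<rat> \<times> \<rat>) \<subseteq> {0..1}"
    using f by (auto simp: partial_solution_def)
  ultimately show ?thesis
    by (intro exI[of _ "case_prod f"])
      (auto simp: closure_of_subtopology Int_absorb1 is_singleton_def)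
qed

end
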